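(* The 4-simplex, i.e. the complete graph on 5 vertices, is an integrable graph.
   Context: Let $H$ denote three-dimensional hyperbolic space (constant curvature $-1$) with distance function $d$ and Riemannian volume measure $\mathrm{d}x$ (in geodesic spherical coordinates about a point, $\mathrm{d}x=\sinh^2 r\,\mathrm{d}r\,\mathrm{d}\Omega$, with $\mathrm{d}\Omega$ Lebesgue measure on the unit 2-sphere). For $p\ge 0$ and $x,y\in H$ with $r=d(x,y)$, put $K_p(x,y)=K_p(r)=\frac{\sin pr}{p\sinh r}$ for $p,r>0$, extended continuously to $p,r\ge 0$: $K_p(0)=1$ and $K_0(r)=r/\sinh r$. Graphs are finite and connected. Let $\Gamma$ be such a graph with vertex set $V$ and edge set $E$, and let $p\colon E\to[0,\infty)$ be a labelling of the edges. Let $s(e),t(e)$ be the two endpoints of $e\in E$ (in either order; $K_p$ is symmetric), choose a vertex $w\in V$ and a point $x_w\in H$, and let $V'=V\setminus\{w\}$. The labelled graph $(\Gamma,p)$ (a relativistic spin network) is called integrable if $$\int_{H^{V'}}\Big|\prod_{e\in E}K_{p(e)}(x_{s(e)},x_{t(e)})\Big|\prod_{v\in V'}\mathrm{d}x_v<\infty .$$ By invariance under the isometries of $H$ this does not depend on the choice of $w$ and $x_w$. The graph $\Gamma$ is called integrable if $(\Gamma,p)$ is integrable for every choice of edge labels $p\colon E\to[0,\infty)$. *)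

theory Defs
  imports "HOL-Analysis.Analysis" "Graph_Theory.Digraph_Component"
begin

section \<open>Hyperbolic three-space\<close>

text \<open>The hyperboloid model in Minkowski space, with time coordinate first and
  signature \<open>(-, +, +, +)\<close>.\<close>

definition lorentz :: "real \<times> (real^3) \<Rightarrow> real \<times> (real^3) \<Rightarrow> real" where
  "lorentz x y = snd x \<bullet> snd y - fst x * fst y"

definition hyp_space :: "(real \<times> (real^3)) set" where
  "hyp_space = {x. lorentz x x = -1 \<and> fst x > 0}"

definition hyp_dist :: "real \<times> (real^3) \<Rightarrow> real \<times> (real^3) \<Rightarrow> real" where
  "hyp_dist x y = arcosh (- lorentz x y)"

text \<open>The hyperboloid is the graph of \<open>u \<mapsto> sqrt (1 + |u|^2)\<close>. In this global chart the Riemannian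
  volume is \<open>sqrt (det g) du\<close>, where \<open>g\<close> is the metric induced by the Lorentz form, of
  curvature \<open>-1\<close>.\<close>

definition hyp_chart :: "real^3 \<Rightarrow> real \<times> (real^3)" where
  "hyp_chart u = (sqrt (1 + (norm u)\<^sup>2), u)"

definition hyp_metric :: "real^3 \<Rightarrow> real^3^3" where
  "hyp_metric u = (\<chi> i j. lorentz (frechet_derivative hyp_chart (at u) (axis i 1))
                                  (frechet_derivative hyp_chart (at u) (axis j 1)))"

definition hyp_volume :: "(real \<times> (real^3)) measure" where
  "hyp_volume = distr (density lborel (\<lambda>u. ennreal (sqrt (det (hyp_metric u)))))
                      (restrict_space borel hyp_space) hyp_chart"

lemma hyp_chart_in_hyp_space: "hyp_chart u \<in> hyp_space"
proof -
  have "1 + u \<bullet> u > 0"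
    by (simp add: add_pos_nonneg)
  then show ?thesis
    by (simp add: hyp_chart_def hyp_space_def lorentz_def power2_norm_eq_inner)
qed

lemma bij_betw_hyp_chart: "bij_betw hyp_chart UNIV hyp_space"
proof (rule bij_betw_byWitness[where f' = snd])
  show "\<forall>x\<in>hyp_space. hyp_chart (snd x) = x"
  proof
    fix x assume "x \<in> hyp_space"
    then have "1 + (norm (snd x))\<^sup>2 = (fst x)\<^sup>2" and "fst x > 0"
      by (auto simp: hyp_space_def lorentz_def power2_norm_eq_inner power2_eq_square[of "fst x"])
    then show "hyp_chart (snd x) = x"
      by (simp add: hyp_chart_def prod_eq_iff)
  qed
qed (use hyp_chart_in_hyp_space in \<open>auto simp: hyp_chart_def\<close>)

lemma frechet_derivative_hyp_chart:
  "frechet_derivative hyp_chart (at u) = (\<lambda>h. (u \<bullet> h / sqrt (1 + (norm u)\<^sup>2), h))"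
proof -
  have pos: "1 + (norm u)\<^sup>2 > 0"
    by (simp add: add_pos_nonneg)
  have "(hyp_chart has_derivative (\<lambda>h. (u \<bullet> h / sqrt (1 + (norm u)\<^sup>2), h))) (at u)"
    unfolding hyp_chart_def[abs_def] power2_norm_eq_inner
    using pos by (auto intro!: derivative_eq_intros
      simp: power2_norm_eq_inner inner_commute field_simps)
  then show ?thesis
    by (rule frechet_derivative_at[symmetric])
qed

lemma sqrt_det_hyp_metric: "sqrt (det (hyp_metric u)) = 1 / sqrt (1 + (norm u)\<^sup>2)"
proof -
  define q where "q = 1 + (norm u)\<^sup>2"
  have pos: "q > 0"
    by (simp add: q_def add_pos_nonneg)
  have q: "q = 1 + (u$1 * u$1 + u$2 * u$2 + u$3 * u$3)"
    unfolding q_def power2_norm_eq_inner by (simp add: inner_vec_def sum_3)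
  have g: "hyp_metric u $ i $ j = (if i = j then 1 else 0) - u$i * u$j / q" for i j
  proof -
    have "sqrt q * sqrt q = q"
      using pos by simp
    moreover have "axis i (1::real) $ j = (if i = j then 1 else 0)"
      by (simp add: axis_def)
    ultimately show ?thesis
      by (simp add: hyp_metric_def frechet_derivative_hyp_chart lorentz_def inner_axis
          inner_axis_axis flip: q_def)
  qed
  have "det (hyp_metric u) = 1 - (u$1 * u$1 + u$2 * u$2 + u$3 * u$3) / q"
    unfolding det_3 g by (simp add: algebra_simps add_divide_distrib diff_divide_distrib)
  also have "\<dots> = 1 / q"
    using pos by (simp add: q field_simps)
  finally show ?thesis
    by (simp add: q_def real_sqrt_divide)
qed

lemma measurable_hyp_chart: "hyp_chart \<in> borel \<rightarrow>\<^sub>M restrict_space borel hyp_space"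
proof (rule measurable_restrict_space2)
  have "continuous_on UNIV hyp_chart"
    unfolding hyp_chart_def[abs_def] by (intro continuous_intros)
  then show "hyp_chart \<in> borel_measurable borel"
    by (rule borel_measurable_continuous_onI)
qed (use hyp_chart_in_hyp_space in auto)

lemma nn_integral_hyp_volume:
  assumes [measurable]: "f \<in> borel_measurable (restrict_space borel hyp_space)"
  shows "(\<integral>\<^sup>+ x. f x \<partial>hyp_volume) =
         (\<integral>\<^sup>+ u. ennreal (1 / sqrt (1 + (norm u)\<^sup>2)) * f (hyp_chart u) \<partial>lborel)"
proof -
  note [measurable] = measurable_hyp_chart
  show ?thesis
    unfolding hyp_volume_def sqrt_det_hyp_metric
    by (subst nn_integral_distr, simp_all, subst nn_integral_density, auto)
qed

section \<open>Relativistic spin networks\<close>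

definition spin_kernel :: "real \<Rightarrow> real \<Rightarrow> real" where
  "spin_kernel p r =
     (if r = 0 then 1 else if p = 0 then r / sinh r else sin (p * r) / (p * sinh r))"

text \<open>Undirected graphs, possibly with loops and parallel edges, are rendered as digraphs having
  exactly one arc per edge: the orientation is the arbitrary choice of \<open>s(e)\<close> and \<open>t(e)\<close>.\<close>

definition edges_product ::
    "('v,'e) pre_digraph \<Rightarrow> ('e \<Rightarrow> real) \<Rightarrow> ('v \<Rightarrow> real \<times> (real^3)) \<Rightarrow> real" where
  "edges_product G p x = (\<Prod>e\<in>arcs G. spin_kernel (p e) (hyp_dist (x (tail G e)) (x (head G e))))"

text \<open>The integral does not depend on the vertex \<open>w\<close> and the point \<open>a\<close> (the \<open>x_w\<close> of the
  literature) at which one variable is fixed; integrability is required for every choice.\<close>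

definition integrable_network :: "('v,'e) pre_digraph \<Rightarrow> ('e \<Rightarrow> real) \<Rightarrow> bool" where
  "integrable_network G p \<longleftrightarrow>
     (\<forall>w\<in>verts G. \<forall>a\<in>hyp_space.
        (\<integral>\<^sup>+ x. ennreal \<bar>edges_product G p (x(w := a))\<bar>
           \<partial>(\<Pi>\<^sub>M v\<in>verts G - {w}. hyp_volume)) < \<infinity>)"

definition integrable_graph :: "('v,'e) pre_digraph \<Rightarrow> bool" where
  "integrable_graph G \<longleftrightarrow>
     fin_digraph G \<and> Digraph_Component.connected G \<and>
     (\<forall>p. (\<forall>e\<in>arcs G. p e \<ge> 0) \<longrightarrow> integrable_network G p)"

text \<open>Not the library's \<open>complete_digraph\<close>, which has two opposite arcs for each edge.\<close>

definition complete_graph :: "nat \<Rightarrow> ('v,'e) pre_digraph \<Rightarrow> bool" where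
  "complete_graph n G \<longleftrightarrow>
     loopfree_digraph G \<and> finite (verts G) \<and> card (verts G) = n \<and>
     (\<forall>u\<in>verts G. \<forall>v\<in>verts G. u \<noteq> v \<longrightarrow> (\<exists>!e. e \<in> arcs G \<and> {tail G e, head G e} = {u, v}))"

end

theory Submission
  imports Defs
begin

text \<open>The kernel satisfies \<open>\<bar>K_p(r)\<bar> \<le> K_0(r) \<le> 20 (cosh r)^{-9/10}\<close>, where \<open>cosh r\<close> is minus the
  Lorentz product of the two points. Every edge of the complete graph on \<open>n\<close> vertices lies in
  exactly two of its \<open>n\<close> stars, so the product over all edges is at most
  \<open>max_v (\<Prod>u\<noteq>v. K(x_u, x_v)) ^ (n/2)\<close>. For \<open>n \<ge> 5\<close> the maximum can be replaced by a sum
  over the centres \<open>v\<close> and the exponent by \<open>5/2\<close>; the integral over a star then factorises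
  into copies of \<open>\<integral> (cosh d(x,y))^{-9/4} dx\<close>, which converges, since the volume grows like
  \<open>(cosh r)^2\<close>, and does not depend on \<open>y\<close> by invariance under Lorentz boosts.\<close>

section \<open>Decay of the kernel\<close>

lemma abs_spin_kernel_le:
  assumes "p \<ge> 0" "r \<ge> 0"
  shows "\<bar>spin_kernel p r\<bar> \<le> 20 * cosh r powr (-9/10)"
proof -
  have cosh1: "cosh r \<ge> 1"
    by (rule cosh_real_ge_1)
  \<comment> \<open>For \<open>r > 0\<close>, the bound
    \<open>\<bar>sin (p * r)\<bar> \<le> p * r\<close> removes the label and leaves
    \<open>r * coth r\<close>, which exceeds \<open>r\<close> by at most 1 because
    \<open>r \<le> sinh r\<close>.\<close>
  have "\<bar>spin_kernel p r\<bar> * cosh r \<le> 1 + r"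
  proof (cases "r = 0")
    case True
    then show ?thesis by (simp add: spin_kernel_def)
  next
    case False
    with assms have r: "r > 0" by simp
    then have sinh: "sinh r > 0" by simp
    have "\<bar>spin_kernel p r\<bar> \<le> r / sinh r"
    proof (cases "p = 0")
      case False
      with assms have p: "p > 0" by simp
      have "\<bar>sin (p * r)\<bar> \<le> p * r"
        using abs_sin_x_le_abs_x[of "p * r"] p r by (simp add: abs_mult)
      then show ?thesis
        using p r sinh by (simp add: spin_kernel_def abs_mult field_simps)
    qed (use r sinh in \<open>simp add: spin_kernel_def\<close>)
    then have "\<bar>spin_kernel p r\<bar> * cosh r \<le> r / sinh r * cosh r"
      by (intro mult_right_mono) auto
    also have "\<dots> = r + r * exp (-r) / sinh r"
    proof -
      have "cosh r = sinh r + exp (- r)"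
        using cosh_minus_sinh[of r] by simp
      then show ?thesis
        using sinh by (simp only: distrib_left add_divide_distrib times_divide_eq_left) simp
    qed
    also have "\<dots> \<le> 1 + r"
    proof -
      have "r * exp (-r) \<le> r"
        using r by simp
      also have "r \<le> sinh r"
        using r real_le_x_sinh[of r] by (simp add: sinh_def exp_minus)
      finally show ?thesis
        using sinh by simp
    qed
    finally show ?thesis .
  qed
  \<comment> \<open>The linear factor is traded for \<open>cosh r powr (1/10)\<close>:
    \<open>exp s \<ge> 1 + s\<close> at \<open>s = r / 10\<close> costs the constant 10, and
    \<open>exp r \<le> 2 * cosh r\<close> a further factor below 2. Any decay exponent of absolute
    value strictly between 4/5 and 1 would serve, since 5/2 times it has to exceed 2.\<close>
  also have "1 + r \<le> 10 * exp (r / 10)"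
    using exp_ge_add_one_self[of "r / 10"] by linarith
  also have "exp (r / 10) = exp r powr (1/10)"
    by (simp add: powr_def)
  also have "exp r powr (1/10) \<le> (2 * cosh r) powr (1/10)"
    by (intro powr_mono2) (auto simp: cosh_def)
  also have "\<dots> = 2 powr (1/10) * cosh r powr (1/10)"
    using cosh1 by (simp add: powr_mult)
  also have "2 powr (1/10) \<le> (2::real) powr 1"
    by (intro powr_mono) auto
  finally have "\<bar>spin_kernel p r\<bar> * cosh r \<le> 20 * cosh r powr (1/10)"
    by (simp add: mult_right_mono)
  also have "\<dots> = 20 * cosh r powr (-9/10) * cosh r"
    using cosh1 powr_add[of "cosh r" "-9/10" 1] by simp
  finally show ?thesis
    using cosh1 by simp
qed

section \<open>The Lorentz product on the hyperboloid\<close>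

lemma fst_hyp_space: "x \<in> hyp_space \<Longrightarrow> fst x = sqrt (1 + (norm (snd x))\<^sup>2)"
  using bij_betw_hyp_chart
  by (auto simp: bij_betw_def hyp_chart_def)

text \<open>Reverse Cauchy-Schwarz inequality; the two sides of the squared inequality in the proof
  differ by the square of \<open>?a - ?b\<close>. It puts \<open>- lorentz x y\<close> into the
  range where \<open>cosh\<close> inverts \<open>arcosh\<close> and where negative powers are at
  most 1.\<close>

lemma lorentz_hyp_space_le:
  assumes "x \<in> hyp_space" "y \<in> hyp_space"
  shows "lorentz x y \<le> -1"
proof -
  let ?a = "norm (snd x)" and ?b = "norm (snd y)"
  have "(1 + ?a * ?b)\<^sup>2 \<le> (1 + ?a\<^sup>2) * (1 + ?b\<^sup>2)"
    using sum_squares_ge_zero[of "?a - ?b" 0] by (simp add: power2_eq_square algebra_simps)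
  then have "1 + ?a * ?b \<le> fst x * fst y"
    using real_le_rsqrt by (simp add: fst_hyp_space assms flip: real_sqrt_mult)
  then show ?thesis
    using norm_cauchy_schwarz[of "snd x" "snd y"] by (simp add: lorentz_def)
qed

lemma lorentz_commute: "lorentz x y = lorentz y x"
  by (simp add: lorentz_def inner_commute mult.commute)

lemma abs_spin_kernel_hyp_dist_le:
  assumes "p \<ge> 0" "x \<in> hyp_space" "y \<in> hyp_space"
  shows "\<bar>spin_kernel p (hyp_dist x y)\<bar> \<le> 20 * (- lorentz x y) powr (-9/10)"
proof -
  have "1 \<le> - lorentz x y"
    using lorentz_hyp_space_le[OF assms(2,3)] by simp
  then show ?thesis
    using abs_spin_kernel_le[OF assms(1), of "hyp_dist x y"] by (simp add: hyp_dist_def)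
qed

section \<open>Change of variables for nonnegative integrands\<close>

text \<open>\<open>has_absolute_integral_change_of_variables\<close> is about absolutely integrable
  vector-valued functions and Lebesgue measure. The scalar nonnegative form follows by passing to
  \<open>real^1\<close> and to the completion of \<open>lborel\<close>, and back.\<close>

lemma nn_integral_change_of_variables:
  fixes f :: "real^'n::{finite,wellorder} \<Rightarrow> real" and g :: "real^'n::_ \<Rightarrow> real^'n::_"
  assumes f: "integrable lborel f" "\<And>x. 0 \<le> f x"
    and g: "\<And>x. (g has_derivative g' x) (at x)" "bij g"
  shows "(\<integral>\<^sup>+ x. ennreal (\<bar>det (matrix (g' x))\<bar> * f (g x)) \<partial>lborel) = (\<integral>\<^sup>+ x. ennreal (f x) \<partial>lborel)"
proof -
  \<comment> \<open>The unit vector \<open>1\<close> spans \<open>real^1\<close>, so the inner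
    product with it undoes this lift.\<close>
  define F where "F x = f x *\<^sub>R (1 :: real^1)" for x
  define D where "D x = \<bar>det (matrix (g' x))\<bar>" for x
  have [simp]: "(1::real^1) \<bullet> 1 = 1"
    by (simp add: inner_vec_def)
  have f': "integrable lebesgue f"
    using f(1) by (simp add: integrable_completion borel_measurable_integrable)
  have F: "F absolutely_integrable_on UNIV"
    unfolding F_def set_integrable_def using f' by (simp add: integrable_scaleR_left)
  have "(\<lambda>x. D x *\<^sub>R F (g x)) absolutely_integrable_on UNIV \<and>
        integral UNIV (\<lambda>x. D x *\<^sub>R F (g x)) = integral UNIV F"
    unfolding D_def
    by (subst has_absolute_integral_change_of_variables) (use g F in \<open>auto simp: bij_def\<close>)
  then have DF: "(\<lambda>x. D x *\<^sub>R F (g x)) absolutely_integrable_on UNIV"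
    and eq: "integral UNIV (\<lambda>x. D x *\<^sub>R F (g x)) = integral UNIV F"
    by auto
  have "integrable lebesgue (\<lambda>x. (D x *\<^sub>R F (g x)) \<bullet> 1)"
    using DF unfolding set_integrable_def by (intro integrable_inner_left) simp
  then have Df: "integrable lebesgue (\<lambda>x. D x * f (g x))"
    by (simp add: F_def)
  have "integral\<^sup>L lebesgue (\<lambda>x. D x * f (g x)) = integral\<^sup>L lebesgue (\<lambda>x. (D x *\<^sub>R F (g x)) \<bullet> 1)"
    by (simp add: F_def)
  also have "\<dots> = integral\<^sup>L lebesgue (\<lambda>x. D x *\<^sub>R F (g x)) \<bullet> 1"
    using DF unfolding set_integrable_def by (intro integral_inner_left) simp
  also have "\<dots> = integral\<^sup>L lebesgue F \<bullet> 1"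
    using eq set_lebesgue_integral_eq_integral(2)[OF DF] set_lebesgue_integral_eq_integral(2)[OF F]
    by (simp add: set_lebesgue_integral_def)
  also have "\<dots> = integral\<^sup>L lebesgue (\<lambda>x. F x \<bullet> 1)"
    using F unfolding set_integrable_def by (intro integral_inner_left[symmetric]) simp
  also have "\<dots> = integral\<^sup>L lebesgue f"
    by (simp add: F_def)
  finally have "(\<integral>\<^sup>+ x. ennreal (D x * f (g x)) \<partial>lebesgue) = (\<integral>\<^sup>+ x. ennreal (f x) \<partial>lebesgue)"
    using f' Df f(2) by (simp add: nn_integral_eq_integral D_def)
  then show ?thesis
    by (simp add: nn_integral_completion D_def)
qed

section \<open>Lorentz boosts in the chart\<close>

text \<open>The spatial part of the Lorentz boost that carries \<open>hyp_chart v\<close> to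
  \<open>(1, 0)\<close>. With \<open>t\<close> the time coordinate of \<open>hyp_chart v\<close>,
  the factor \<open>1 / (1 + t)\<close> is the usual \<open>(t - 1) / (norm v)\<^sup>2\<close>,
  written so that \<open>v = 0\<close> is no exception.\<close>

definition boost :: "real^3 \<Rightarrow> real^3 \<Rightarrow> real^3" where
  "boost v u = u + (v \<bullet> u / (1 + sqrt (1 + (norm v)\<^sup>2)) - sqrt (1 + (norm u)\<^sup>2)) *\<^sub>R v"

text \<open>The time coordinate of a point is minus its Lorentz product with \<open>(1, 0)\<close>.
  The boost moves \<open>hyp_chart v\<close> there and preserves the product, so the new time
  coordinate is a product of the old points. The proof checks this by direct computation.\<close>

lemma sqrt_norm_boost:
  "sqrt (1 + (norm (boost v u))\<^sup>2) = - lorentz (hyp_chart u) (hyp_chart v)"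
proof -
  define t where "t = sqrt (1 + (norm v)\<^sup>2)"
  define E where "E = sqrt (1 + (norm u)\<^sup>2)"
  define m where "m = u \<bullet> v"
  have t: "t > 0" "t * t = 1 + v \<bullet> v" and E: "E * E = 1 + u \<bullet> u"
    by (simp_all add: t_def E_def power2_norm_eq_inner add_pos_nonneg)
  have vv: "v \<bullet> v = t * t - 1" and uu: "u \<bullet> u = E * E - 1"
    using t E by auto
  define k where "k = m / (1 + t) - E"
  \<comment> \<open>Free of division, so that the identity needed below is polynomial and within
    reach of \<open>algebra\<close>.\<close>
  have k: "(1 + t) * k = m - (1 + t) * E"
    using t(1) by (simp add: k_def field_simps)
  have "boost v u = u + k *\<^sub>R v"
    by (simp add: boost_def k_def m_def t_def E_def inner_commute)
  then have "boost v u \<bullet> boost v u = u \<bullet> u + 2 * k * m + k\<^sup>2 * (v \<bullet> v)"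
    by (simp add: inner_simps inner_commute m_def power2_eq_square algebra_simps)
  also have "\<dots> = (t * E - m)\<^sup>2 - 1"
    unfolding vv uu using k by algebra
  finally have "1 + (norm (boost v u))\<^sup>2 = (t * E - m)\<^sup>2"
    by (simp add: power2_norm_eq_inner)
  moreover have "lorentz (hyp_chart u) (hyp_chart v) = m - t * E"
    by (simp add: lorentz_def hyp_chart_def t_def E_def m_def)
  \<comment> \<open>The square fixes \<open>t * E - m\<close> only up to sign; the reverse
    Cauchy-Schwarz bound settles the sign.\<close>
  moreover have "t * E - m \<ge> 0"
    using lorentz_hyp_space_le[OF hyp_chart_in_hyp_space hyp_chart_in_hyp_space, of u v] calculation
    by simp
  ultimately show ?thesis by simp
qed

text \<open>The new time coordinate \<open>t * E - m\<close> is known from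
  \<open>sqrt_norm_boost\<close>; with it the second boost subtracts exactly the multiple
  \<open>k\<close> of \<open>v\<close> that the first one added.\<close>

lemma boost_uminus_boost: "boost (- v) (boost v u) = u"
proof -
  define t where "t = sqrt (1 + (norm v)\<^sup>2)"
  define E where "E = sqrt (1 + (norm u)\<^sup>2)"
  define m where "m = v \<bullet> u"
  define k where "k = m / (1 + t) - E"
  have t: "t > 0" "t * t = 1 + v \<bullet> v"
    by (simp_all add: t_def power2_norm_eq_inner add_pos_nonneg)
  then have vv: "v \<bullet> v = t * t - 1" by simp
  have b: "boost v u = u + k *\<^sub>R v"
    by (simp add: boost_def k_def m_def t_def E_def)
  have E': "sqrt (1 + (norm (boost v u))\<^sup>2) = t * E - m"
    by (simp add: sqrt_norm_boost lorentz_def hyp_chart_def t_def E_def m_def inner_commute)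
  have "boost (- v) (boost v u) =
      boost v u - ((- v) \<bullet> boost v u / (1 + t) - (t * E - m)) *\<^sub>R v"
    unfolding boost_def[of "- v"] E' by (simp flip: t_def)
  also have "(- v) \<bullet> boost v u = - (m + k * (t * t - 1))"
    unfolding b by (simp add: inner_simps vv algebra_simps flip: m_def)
  also have "- (m + k * (t * t - 1)) / (1 + t) - (t * E - m) = k"
  proof -
    have "(1 + t) * k = m - (1 + t) * E"
      using t(1) by (simp add: k_def field_simps)
    then have "- (m + k * (t * t - 1)) = (k + (t * E - m)) * (1 + t)"
      by algebra
    then show ?thesis
      using t(1) by (simp add: eq_divide_eq[symmetric] diff_eq_eq divide_eq_eq)
  qed
  finally show ?thesis
    by (simp add: b)
qed

lemma bij_boost: "bij (boost v)"
proof (rule bij_betw_byWitness[where f' = "boost (- v)"])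
  show "\<forall>u\<in>UNIV. boost v (boost (- v) u) = u"
    using boost_uminus_boost[of "- v"] by simp
qed (simp_all add: boost_uminus_boost)

text \<open>The matrix determinant lemma in dimension three, expanded by hand. It yields the
  Jacobian of a boost.\<close>

lemma det_matrix_rank_one_update:
  fixes c v :: "real^3"
  shows "det (matrix (\<lambda>h. h + (c \<bullet> h) *\<^sub>R v)) = 1 + c \<bullet> v"
  unfolding det_3 matrix_def
  by (simp add: inner_axis axis_def inner_vec_def sum_3 algebra_simps)

text \<open>Both terms of the coefficient of \<open>v\<close> are gathered in one inner product with
  \<open>h\<close>, so that the derivative is visibly the identity plus a map of rank one.\<close>

lemma has_derivative_boost:
  "(boost v has_derivative
     (\<lambda>h. h + (((1 / (1 + sqrt (1 + (norm v)\<^sup>2))) *\<^sub>R v - (1 / sqrt (1 + (norm u)\<^sup>2)) *\<^sub>R u) \<bullet> h) *\<^sub>R v))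
     (at u)"
proof -
  define t where "t = 1 + sqrt (1 + (norm v)\<^sup>2)"
  have pos: "1 + u \<bullet> u > 0"
    by (simp add: add_pos_nonneg)
  have "t > 0"
    by (simp add: t_def add_pos_nonneg)
  have "((\<lambda>u. sqrt (1 + u \<bullet> u)) has_derivative (\<lambda>h. u \<bullet> h / sqrt (1 + u \<bullet> u))) (at u)"
    using pos by (auto intro!: derivative_eq_intros simp: inner_commute field_simps)
  moreover have "((\<lambda>u. v \<bullet> u / t) has_derivative (\<lambda>h. v \<bullet> h / t)) (at u)"
    using \<open>t > 0\<close> by (auto intro!: derivative_eq_intros)
  ultimately have "((\<lambda>u. u + (v \<bullet> u / t - sqrt (1 + u \<bullet> u)) *\<^sub>R v) has_derivative
      (\<lambda>h. h + (v \<bullet> h / t - u \<bullet> h / sqrt (1 + u \<bullet> u)) *\<^sub>R v)) (at u)"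
    by (intro has_derivative_add has_derivative_ident has_derivative_scaleR_left has_derivative_diff)
  then show ?thesis
    by (simp add: boost_def[abs_def] power2_norm_eq_inner inner_diff_left t_def)
qed

section \<open>Convergence of the radial integral\<close>

text \<open>One coordinate's share of the three-dimensional integral: \<open>-13/12\<close> is a
  third of \<open>-13/4\<close> and still below -1, so the tail converges.\<close>

lemma nn_integral_one_plus_abs_powr_finite:
  "(\<integral>\<^sup>+ s. ennreal (((1 + \<bar>s\<bar>) / 2) powr (-13/12)) \<partial>lborel) < \<infinity>"
proof -
  define f :: "real \<Rightarrow> real" where "f s = ((1 + \<bar>s\<bar>) / 2) powr (-13/12)" for s
  have [measurable]: "f \<in> borel_measurable borel"
    unfolding f_def by measurable
  have half: "(\<integral>\<^sup>+ s. ennreal (f s) * indicator {0..} s \<partial>lborel) < \<infinity>"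
  proof -
    \<comment> \<open>The antiderivative of \<open>f\<close> on the half-line; 24 cancels the
      exponent \<open>1/12\<close> and the inner derivative \<open>1/2\<close>.\<close>
    have lim: "((\<lambda>s::real. - 24 * ((1 + s) / 2) powr (-1/12)) \<longlongrightarrow> 0) at_top"
    proof -
      have "filterlim (\<lambda>s::real. 1 / 2 * (1 + s)) at_top at_top"
        by (intro filterlim_tendsto_pos_mult_at_top[OF tendsto_const]
            filterlim_tendsto_add_at_top[OF tendsto_const] filterlim_ident) simp
      then show ?thesis
        by (intro tendsto_mult_right_zero tendsto_neg_powr) simp_all
    qed
    have "(\<integral>\<^sup>+ s. ennreal (f s) * indicator {0..} s \<partial>lborel) =
        ennreal (0 - (- 24 * ((1 + 0) / 2) powr (-1/12)))"
    proof (rule nn_integral_FTC_atLeast[OF _ _ _ lim])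
      fix s :: real assume s: "0 \<le> s"
      show "DERIV (\<lambda>s. - 24 * ((1 + s) / 2) powr (-1/12)) s :> f s"
        using s by (auto intro!: derivative_eq_intros simp: f_def)
    qed (auto simp: f_def)
    then show ?thesis by simp
  qed
  \<comment> \<open>\<open>f\<close> is even, so two half-lines suffice. Both indicators are 1 at
    \<open>s = 0\<close>, hence an inequality.\<close>
  have "(\<integral>\<^sup>+ s. ennreal (f s) \<partial>lborel) \<le>
      (\<integral>\<^sup>+ s. ennreal (f s) * indicator {0..} s + ennreal (f (- s)) * indicator {0..} (- s) \<partial>lborel)"
    by (intro nn_integral_mono) (auto simp: f_def indicator_def)
  also have "\<dots> = (\<integral>\<^sup>+ s. ennreal (f s) * indicator {0..} s \<partial>lborel) +
      (\<integral>\<^sup>+ s. ennreal (f (- s)) * indicator {0..} (- s) \<partial>lborel)"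
    by (intro nn_integral_add) auto
  also have "(\<integral>\<^sup>+ s. ennreal (f (- s)) * indicator {0..} (- s) \<partial>lborel) =
      (\<integral>\<^sup>+ s. ennreal (f s) * indicator {0..} s \<partial>lborel)"
    using nn_integral_real_affine[of "\<lambda>s. ennreal (f s) * indicator {0..} s" "-1" 0] by simp
  finally have "(\<integral>\<^sup>+ s. ennreal (f s) \<partial>lborel) < \<infinity>"
    by (rule le_less_trans) (use half in simp)
  then show ?thesis
    by (simp add: f_def)
qed

text \<open>Instead of polar coordinates, the radial integrand is bounded by a product of functions
  of single coordinates, over which the integral factorises. The exponent \<open>-13/4\<close>
  collects \<open>-9/4\<close> from a star edge and -1 from the volume density.\<close>

lemma nn_integral_sqrt_norm_powr_finite:
  "(\<integral>\<^sup>+ u. ennreal (sqrt (1 + (norm u)\<^sup>2) powr (-13/4)) \<partial>(lborel :: (real^3) measure)) < \<infinity>"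
proof -
  define f :: "real \<Rightarrow> ennreal" where "f s = ennreal (((1 + \<bar>s\<bar>) / 2) powr (-13/12))" for s
  have [measurable]: "f \<in> borel_measurable borel"
    unfolding f_def by measurable
  have "ennreal (sqrt (1 + (norm u)\<^sup>2) powr (-13/4)) \<le> (\<Prod>b\<in>Basis. f (u \<bullet> b))" for u :: "real^3"
  proof -
    let ?E = "sqrt (1 + (norm u)\<^sup>2)"
    have E: "?E > 0"
      by (simp add: add_pos_nonneg)
    have "?E powr (-13/4) = (?E powr (-13/12)) ^ 3"
      using E by (simp add: powr_powr flip: powr_realpow)
    also have "\<dots> = (\<Prod>b\<in>(Basis :: (real^3) set). ?E powr (-13/12))"
      by simp
    also have "\<dots> \<le> (\<Prod>b\<in>Basis. ((1 + \<bar>u \<bullet> b\<bar>) / 2) powr (-13/12))"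
    proof (intro prod_mono conjI)
      fix b :: "real^3" assume b: "b \<in> Basis"
      have 1: "(1 + \<bar>u \<bullet> b\<bar>) / 2 \<le> (1 + norm u) / 2"
        using Basis_le_norm[OF b, of u] by simp
      have "((1 + norm u) / 2)\<^sup>2 \<le> 1 + (norm u)\<^sup>2"
        proof -
        \<comment> \<open>This is four times the right-hand side minus
          \<open>(1 + norm u)\<^sup>2\<close>.\<close>
        have "0 \<le> (1 - norm u)\<^sup>2 + 2 * (1 + (norm u)\<^sup>2)"
          by simp
        then show ?thesis
          by (simp add: power_divide power2_diff power2_sum)
      qed
      then have "(1 + norm u) / 2 \<le> ?E"
        by (rule real_le_rsqrt)
      with 1 show "?E powr (-13/12) \<le> ((1 + \<bar>u \<bullet> b\<bar>) / 2) powr (-13/12)"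
        by (intro powr_mono2') auto
    qed auto
    finally show ?thesis
      by (simp add: f_def prod_ennreal ennreal_leI)
  qed
  then have "(\<integral>\<^sup>+ u. ennreal (sqrt (1 + (norm u)\<^sup>2) powr (-13/4)) \<partial>(lborel :: (real^3) measure)) \<le>
      (\<integral>\<^sup>+ u. (\<Prod>b\<in>Basis. f (u \<bullet> b)) \<partial>(lborel :: (real^3) measure))"
    by (intro nn_integral_mono)
  also have "\<dots> = (\<Prod>b\<in>(Basis :: (real^3) set). \<integral>\<^sup>+ s. f s \<partial>lborel)"
    by (rule nn_integral_lborel_prod) auto
  also have "\<dots> < \<infinity>"
    using nn_integral_one_plus_abs_powr_finite by (simp add: f_def power_less_top_ennreal)
  finally show ?thesis .
qed

section \<open>Measurability, boost invariance and sigma-finiteness of the volume\<close>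

lemma sets_hyp_volume [measurable_cong]: "sets hyp_volume = sets (restrict_space borel hyp_space)"
  by (simp add: hyp_volume_def)

lemma space_hyp_volume [simp]: "space hyp_volume = hyp_space"
  by (simp add: hyp_volume_def space_restrict_space)

text \<open>\<open>hyp_volume\<close> carries the trace of the Borel sets on the hyperboloid;
  measurability of \<open>lorentz\<close> is available in the ambient space.\<close>

lemma measurable_hyp_volume_borel: "f \<in> M \<rightarrow>\<^sub>M hyp_volume \<Longrightarrow> f \<in> M \<rightarrow>\<^sub>M borel"
  unfolding measurable_cong_sets[OF refl sets_hyp_volume] by (rule measurable_restrict_space2_iff[THEN iffD1, THEN conjunct1])

lemma measurable_lorentz [measurable]:
  assumes "f \<in> M \<rightarrow>\<^sub>M borel" "g \<in> M \<rightarrow>\<^sub>M borel"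
  shows "(\<lambda>x. lorentz (f x) (g x)) \<in> borel_measurable M"
proof -
  have "(\<lambda>x. snd (f x)) \<in> M \<rightarrow>\<^sub>M borel" "(\<lambda>x. snd (g x)) \<in> M \<rightarrow>\<^sub>M borel"
    "(\<lambda>x. fst (f x)) \<in> M \<rightarrow>\<^sub>M borel" "(\<lambda>x. fst (g x)) \<in> M \<rightarrow>\<^sub>M borel"
    using assms by (auto intro!: borel_measurable_continuous_on[where g = f] borel_measurable_continuous_on[where g = g] continuous_intros)
  then show ?thesis
    unfolding lorentz_def by measurable
qed

text \<open>The boost that moves \<open>y\<close> to the origin turns the integrand into a radial
  one, so the value is the same for every \<open>y\<close>.\<close>

lemma nn_integral_lorentz_powr:
  assumes "y \<in> hyp_space"
  shows "(\<integral>\<^sup>+ x. ennreal ((- lorentz x y) powr (-9/4)) \<partial>hyp_volume) =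
         (\<integral>\<^sup>+ u. ennreal (sqrt (1 + (norm u)\<^sup>2) powr (-13/4)) \<partial>(lborel :: (real^3) measure))"
proof -
  define v where "v = snd y"
  have y: "y = hyp_chart v"
    using fst_hyp_space[OF assms] by (simp add: v_def hyp_chart_def prod_eq_iff)
  define f :: "real^3 \<Rightarrow> real" where "f u = sqrt (1 + (norm u)\<^sup>2) powr (-13/4)" for u
  have [measurable]: "f \<in> borel_measurable borel"
    unfolding f_def by measurable
  have id: "(\<lambda>x. x) \<in> restrict_space borel hyp_space \<rightarrow>\<^sub>M (borel :: (real \<times> (real^3)) measure)"
    by (rule measurable_restrict_space1) simp
  have "(\<lambda>x. lorentz x y) \<in> borel_measurable (restrict_space borel hyp_space)"
    by (rule measurable_lorentz[OF id]) simp
  then have "(\<lambda>x. ennreal ((- lorentz x y) powr (-9/4))) \<in> borel_measurable (restrict_space borel hyp_space)"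
    by measurable
  then have "(\<integral>\<^sup>+ x. ennreal ((- lorentz x y) powr (-9/4)) \<partial>hyp_volume) =
    (\<integral>\<^sup>+ u. ennreal (1 / sqrt (1 + (norm u)\<^sup>2)) * ennreal ((- lorentz (hyp_chart u) y) powr (-9/4)) \<partial>lborel)"
    by (rule nn_integral_hyp_volume)
  also have "\<dots> = (\<integral>\<^sup>+ u. ennreal (\<bar>det (matrix (\<lambda>h. h +
      (((1 / (1 + sqrt (1 + (norm v)\<^sup>2))) *\<^sub>R v - (1 / sqrt (1 + (norm u)\<^sup>2)) *\<^sub>R u) \<bullet> h) *\<^sub>R v))\<bar>
      * f (boost v u)) \<partial>lborel)"
  proof (rule nn_integral_cong)
    fix u :: "real^3"
    define t where "t = sqrt (1 + (norm v)\<^sup>2)"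
    define E where "E = sqrt (1 + (norm u)\<^sup>2)"
    define l where "l = - lorentz (hyp_chart u) y"
    have t: "t > 0" "t * t = 1 + v \<bullet> v" and E: "E > 0"
      by (simp_all add: t_def E_def power2_norm_eq_inner add_pos_nonneg)
    have l: "l \<ge> 1"
      using lorentz_hyp_space_le[OF hyp_chart_in_hyp_space assms] unfolding l_def by simp
    have l_eq: "l = t * E - u \<bullet> v"
      by (simp add: l_def y lorentz_def hyp_chart_def t_def E_def)
    have vv: "v \<bullet> v = t * t - 1"
      using t by simp
    have "v \<bullet> v / (1 + t) = t - 1"
      using t(1) by (simp add: vv field_simps)
    \<comment> \<open>The Jacobian of the boost is the ratio of the new time coordinate
      \<open>l\<close> to the old one \<open>E\<close>: this is the invariance of the hyperbolic
      volume, whose density is \<open>1 / E\<close>.\<close>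
    then have "1 + ((1 / (1 + t)) *\<^sub>R v - (1 / E) *\<^sub>R u) \<bullet> v = l / E"
      unfolding l_eq using E by (simp add: inner_simps diff_divide_distrib)
    moreover have "f (boost v u) = l powr (-13/4)"
      by (simp add: f_def sqrt_norm_boost l_def y)
    moreover have "l / E * l powr (-13/4) = 1 / E * l powr (-9/4)"
      using l powr_add[of l 1 "-13/4"] by simp
    ultimately show "ennreal (1 / sqrt (1 + (norm u)\<^sup>2)) * ennreal ((- lorentz (hyp_chart u) y) powr (-9/4)) =
      ennreal (\<bar>det (matrix (\<lambda>h. h +
        (((1 / (1 + sqrt (1 + (norm v)\<^sup>2))) *\<^sub>R v - (1 / sqrt (1 + (norm u)\<^sup>2)) *\<^sub>R u) \<bullet> h) *\<^sub>R v))\<bar>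
        * f (boost v u))"
      unfolding det_matrix_rank_one_update using l E
      by (simp flip: t_def E_def l_def ennreal_mult')
  qed
  also have "\<dots> = (\<integral>\<^sup>+ u. ennreal (f u) \<partial>lborel)"
  proof (rule nn_integral_change_of_variables)
    show "integrable lborel f"
      using nn_integral_sqrt_norm_powr_finite
      by (intro integrableI_nonneg) (auto simp: f_def)
  qed (auto simp: f_def has_derivative_boost bij_boost)
  finally show ?thesis
    by (simp add: f_def)
qed

text \<open>The points over the balls of radius \<open>n\<close> in the chart exhaust the space. The
  density is at most 1, so their volume is bounded by that of a Euclidean ball. Product integrals
  over several vertices rest on this.\<close>

lemma sigma_finite_hyp_volume: "sigma_finite_measure hyp_volume"
proof
  define A where "A n = {x \<in> hyp_space. snd x \<in> cball 0 (real n)}" for n :: nat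
  have id: "(\<lambda>x. x) \<in> restrict_space borel hyp_space \<rightarrow>\<^sub>M (borel :: (real \<times> (real^3)) measure)"
    by (rule measurable_restrict_space1) simp
  have snd': "snd \<in> restrict_space borel hyp_space \<rightarrow>\<^sub>M (borel :: (real^3) measure)"
    by (rule borel_measurable_continuous_on[OF _ id]) (intro continuous_intros)
  have A: "A n \<in> sets hyp_volume" for n
    using measurable_sets[OF snd', of "cball 0 (real n)"]
    by (simp add: A_def sets_hyp_volume vimage_def Int_def space_restrict_space conj_commute)
  have "emeasure hyp_volume (A n) \<noteq> \<infinity>" for n
  proof -
    have "emeasure hyp_volume (A n) = (\<integral>\<^sup>+ x. indicator (A n) x \<partial>hyp_volume)"
      using A by simp
    also have "\<dots> = (\<integral>\<^sup>+ u. ennreal (1 / sqrt (1 + (norm u)\<^sup>2)) * indicator (A n) (hyp_chart u) \<partial>lborel)"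
      using A[of n] by (intro nn_integral_hyp_volume) (simp add: sets_hyp_volume)
    also have "\<dots> \<le> (\<integral>\<^sup>+ u. indicator (cball 0 (real n)) u \<partial>(lborel :: (real^3) measure))"
      by (intro nn_integral_mono) (auto simp: indicator_def A_def hyp_chart_def add_pos_nonneg divide_le_eq_1)
    also have "\<dots> = emeasure lborel (cball (0::real^3) (real n))"
      by simp
    also have "\<dots> < \<infinity>"
      by (rule emeasure_lborel_cball_finite)
    finally show ?thesis by simp
  qed
  moreover have "(\<Union>n. A n) = space hyp_volume"
  proof (intro equalityI subsetI)
    fix x assume x: "x \<in> space hyp_volume"
    obtain n :: nat where "norm (snd x) \<le> real n"
      using real_arch_simple by blast
    with x show "x \<in> (\<Union>n. A n)"
      by (auto simp: A_def)
  qed (auto simp: A_def)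
  ultimately show "\<exists>\<A>. countable \<A> \<and> \<A> \<subseteq> sets hyp_volume \<and> \<Union> \<A> = space hyp_volume \<and>
      (\<forall>a\<in>\<A>. emeasure hyp_volume a \<noteq> \<infinity>)"
    using A by (intro exI[of _ "range A"]) auto
qed

section \<open>Combinatorics of complete graphs\<close>

context
  fixes G :: "('v, 'e) pre_digraph" and n :: nat
  assumes G: "complete_graph n G"
begin

lemma complete_graph_finite_verts: "finite (verts G)"
  and complete_graph_loopfree: "loopfree_digraph G"
  using G by (auto simp: complete_graph_def)

text \<open>Without loops the endpoints are distinct, so the uniqueness clause for pairs of vertices
  applies. Comparing unordered pairs excludes antiparallel arcs as well as parallel ones.\<close>

lemma complete_graph_arc_unique:
  assumes "e \<in> arcs G" "e' \<in> arcs G" "{tail G e, head G e} = {tail G e', head G e'}"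
  shows "e = e'"
proof -
  interpret loopfree_digraph G by (rule complete_graph_loopfree)
  have "tail G e \<in> verts G" "head G e \<in> verts G" "tail G e \<noteq> head G e"
    using assms(1) no_loops by auto
  then have "\<exists>!a. a \<in> arcs G \<and> {tail G a, head G a} = {tail G e, head G e}"
    using G unfolding complete_graph_def by blast
  then show ?thesis
    using assms by (metis (full_types))
qed

lemma complete_graph_finite_arcs: "finite (arcs G)"
proof (rule inj_on_finite)
  interpret loopfree_digraph G by (rule complete_graph_loopfree)
  show "inj_on (\<lambda>e. {tail G e, head G e}) (arcs G)"
    by (intro inj_onI complete_graph_arc_unique)
  show "(\<lambda>e. {tail G e, head G e}) ` arcs G \<subseteq> Pow (verts G)"
    by auto
qed (use complete_graph_finite_verts in simp)

lemma complete_graph_fin_digraph: "fin_digraph G"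
proof -
  interpret loopfree_digraph G by (rule complete_graph_loopfree)
  show ?thesis
    using complete_graph_finite_verts complete_graph_finite_arcs by (rule fin_digraphI)
qed

lemma complete_graph_connected:
  assumes "n > 0"
  shows "Digraph_Component.connected G"
proof -
  have "(u, v) \<in> rtrancl_on (verts G) (symcl (arcs_ends G))" if "u \<in> verts G" "v \<in> verts G" for u v
  proof (cases "u = v")
    case False
    with that obtain e where e: "e \<in> arcs G" "{tail G e, head G e} = {u, v}"
      using G unfolding complete_graph_def by blast
    then have "(u, v) \<in> arcs_ends G \<or> (v, u) \<in> arcs_ends G"
      unfolding arcs_ends_conv doubleton_eq_iff by blast
    then have "(u, v) \<in> symcl (arcs_ends G)"
      by (auto simp: symcl_def)
    then show ?thesis
      using that by (meson rtrancl_on_into_rtrancl_on rtrancl_on_refl)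
  qed (use that in simp)
  moreover have "verts G \<noteq> {}"
    using G assms by (auto simp: complete_graph_def)
  ultimately show ?thesis
    by (simp add: connected_conv)
qed

text \<open>Double counting: every ordered pair of distinct vertices comes from exactly one arc,
  read either forwards (\<open>P\<close>) or backwards (\<open>Q\<close>).\<close>

lemma complete_graph_prod_arcs:
  fixes c :: "'v \<Rightarrow> 'v \<Rightarrow> 'a::comm_monoid_mult"
  shows "(\<Prod>e\<in>arcs G. c (tail G e) (head G e) * c (head G e) (tail G e)) =
         (\<Prod>v\<in>verts G. \<Prod>u\<in>verts G - {v}. c u v)"
proof -
  interpret loopfree_digraph G by (rule complete_graph_loopfree)
  define P where "P = (\<lambda>e. (tail G e, head G e)) ` arcs G"
  define Q where "Q = (\<lambda>e. (head G e, tail G e)) ` arcs G"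
  have inj: "inj_on (\<lambda>e. (tail G e, head G e)) (arcs G)" "inj_on (\<lambda>e. (head G e, tail G e)) (arcs G)"
    by (auto intro!: inj_onI complete_graph_arc_unique)
  have disj: "P \<inter> Q = {}"
  proof (rule ccontr)
    assume "P \<inter> Q \<noteq> {}"
    then obtain e e' where e: "e \<in> arcs G" "e' \<in> arcs G" "tail G e = head G e'" "head G e = tail G e'"
      by (auto simp: P_def Q_def)
    then have "e = e'"
      by (intro complete_graph_arc_unique) auto
    with e no_loops[of e] show False by simp
  qed
  have Un: "P \<union> Q = Sigma (verts G) (\<lambda>v. verts G - {v})"
  proof (intro equalityI subsetI)
    fix z assume "z \<in> P \<union> Q"
    then show "z \<in> Sigma (verts G) (\<lambda>v. verts G - {v})"
      using no_loops by (force simp: P_def Q_def)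
  next
    fix z assume "z \<in> Sigma (verts G) (\<lambda>v. verts G - {v})"
    then obtain u v where z: "z = (u, v)" "u \<in> verts G" "v \<in> verts G" "u \<noteq> v"
      by auto
    then obtain e where e: "e \<in> arcs G" "{tail G e, head G e} = {u, v}"
      using G unfolding complete_graph_def by blast
    with z show "z \<in> P \<union> Q"
      by (force simp: P_def Q_def doubleton_eq_iff)
  qed
  \<comment> \<open>Pairs are listed with the centre \<open>v\<close> first and the leaf
    \<open>u\<close> second, so the first factor belongs to \<open>Q\<close>.\<close>
  have "(\<Prod>e\<in>arcs G. c (tail G e) (head G e) * c (head G e) (tail G e)) =
      (\<Prod>(v,u)\<in>Q. c u v) * (\<Prod>(v,u)\<in>P. c u v)"
    using inj by (simp add: P_def Q_def prod.reindex prod.distrib)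
  also have "\<dots> = (\<Prod>(v,u)\<in>P \<union> Q. c u v)"
    using disj complete_graph_finite_arcs
    by (subst prod.union_disjoint) (auto simp: P_def Q_def mult.commute)
  also have "\<dots> = (\<Prod>v\<in>verts G. \<Prod>u\<in>verts G - {v}. c u v)"
    unfolding Un using complete_graph_finite_verts by (simp add: prod.Sigma)
  finally show ?thesis .
qed

text \<open>The square supplies each arc with one factor for each of its two stars. Taking
  \<open>c\<close> as the square root of an edge weight keeps the exponents natural numbers:
  \<open>k = 5\<close> stands for the power 5/2 of the weight.\<close>

lemma complete_graph_prod_arcs_le_sum_stars:
  fixes c :: "'v \<Rightarrow> 'v \<Rightarrow> real"
  assumes c: "\<And>u v. c u v \<ge> 0" "\<And>u v. u \<in> verts G \<Longrightarrow> v \<in> verts G \<Longrightarrow> c u v \<le> 1" "\<And>u v. c u v = c v u"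
    and n: "0 < k" "k \<le> n"
  shows "(\<Prod>e\<in>arcs G. (c (tail G e) (head G e))\<^sup>2) \<le> (\<Sum>v\<in>verts G. \<Prod>u\<in>verts G - {v}. c u v ^ k)"
proof -
  define S where "S v = (\<Prod>u\<in>verts G - {v}. c u v)" for v
  have fin: "finite (verts G)" and card: "card (verts G) = n"
    using G by (auto simp: complete_graph_def)
  have S: "0 \<le> S v" "v \<in> verts G \<Longrightarrow> S v \<le> 1" for v
    using c by (auto simp: S_def intro!: prod_nonneg prod_le_1)
  have ne: "verts G \<noteq> {}"
    using card n by auto
  obtain w where w: "w \<in> verts G" "\<And>v. v \<in> verts G \<Longrightarrow> S v \<le> S w"
  proof -
    have "Max (S ` verts G) \<in> S ` verts G"
      using fin ne by (intro Max_in) auto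
    then obtain w where "w \<in> verts G" "S w = Max (S ` verts G)"
      by force
    with fin show thesis
      by (intro that[of w]) auto
  qed
  have "(\<Prod>e\<in>arcs G. (c (tail G e) (head G e))\<^sup>2) =
      (\<Prod>e\<in>arcs G. c (tail G e) (head G e) * c (head G e) (tail G e))"
    using c(3) by (simp add: power2_eq_square)
  also have "\<dots> = (\<Prod>v\<in>verts G. S v)"
    unfolding S_def by (rule complete_graph_prod_arcs)
  also have "\<dots> \<le> (\<Prod>v\<in>verts G. S w)"
    using S w by (intro prod_mono) auto
  also have "\<dots> = S w ^ n"
    by (simp add: card)
  \<comment> \<open>As \<open>S w \<le> 1\<close>, lowering the exponent enlarges the power; this
    makes the bound uniform in \<open>n\<close>.\<close>
  also have "\<dots> \<le> S w ^ k"
    using n S w by (intro power_decreasing) auto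
  also have "\<dots> \<le> (\<Sum>v\<in>verts G. S v ^ k)"
    using S w fin by (intro member_le_sum) auto
  finally show ?thesis
    by (simp add: S_def prod_power_distrib)
qed

end

section \<open>Integration over a star\<close>

lemma measurable_lorentz_powr_hyp_volume [measurable]:
  assumes "f \<in> M \<rightarrow>\<^sub>M hyp_volume" "g \<in> M \<rightarrow>\<^sub>M hyp_volume"
  shows "(\<lambda>x. ennreal ((- lorentz (f x) (g x)) powr a)) \<in> borel_measurable M"
proof -
  have "(\<lambda>x. lorentz (f x) (g x)) \<in> borel_measurable M"
    using assms by (intro measurable_lorentz measurable_hyp_volume_borel)
  then show ?thesis by measurable
qed

text \<open>If the centre is the pinned vertex \<open>w\<close>, the integral factorises at once.
  Otherwise the free leaves are integrated first, each giving \<open>J\<close> whatever the position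
  of the centre, and the centre last, against the factor of the pinned leaf. Either way the value is
  a power of \<open>J\<close>.\<close>

lemma nn_integral_star_finite:
  assumes I: "finite I" "w \<notin> I" and a: "a \<in> hyp_space" and v: "v \<in> insert w I"
  shows "(\<integral>\<^sup>+ x. (\<Prod>u\<in>insert w I - {v}. ennreal ((- lorentz ((x(w := a)) u) ((x(w := a)) v)) powr (-9/4)))
            \<partial>(\<Pi>\<^sub>M i\<in>I. hyp_volume)) < \<infinity>"
proof -
  define g where "g x y = ennreal ((- lorentz x y) powr (-9/4))" for x y
  define J where "J = (\<integral>\<^sup>+ u. ennreal (sqrt (1 + (norm u)\<^sup>2) powr (-13/4)) \<partial>(lborel :: (real^3) measure))"
  have J: "J < \<infinity>"
    unfolding J_def by (rule nn_integral_sqrt_norm_powr_finite)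
  have g_J: "(\<integral>\<^sup>+ x. g x y \<partial>hyp_volume) = J" if "y \<in> hyp_space" for y
    unfolding g_def J_def using that by (rule nn_integral_lorentz_powr)
  have g_sym: "g x y = g y x" for x y
    by (simp add: g_def lorentz_commute)
  have g_measurable [measurable]: "(\<lambda>x. g (f x) (h x)) \<in> borel_measurable M"
    if "f \<in> M \<rightarrow>\<^sub>M hyp_volume" "h \<in> M \<rightarrow>\<^sub>M hyp_volume" for f h and M :: "'z measure"
    unfolding g_def using that by (rule measurable_lorentz_powr_hyp_volume)
  interpret product_sigma_finite "\<lambda>i::'a. hyp_volume"
    by (simp add: product_sigma_finite_def sigma_finite_hyp_volume)
  have star: "(\<integral>\<^sup>+ x. (\<Prod>u\<in>K. g (x u) y) \<partial>(\<Pi>\<^sub>M i\<in>K. hyp_volume)) = J ^ card K"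
    if "finite K" "y \<in> hyp_space" for K :: "'a set" and y
    using that by (subst product_nn_integral_prod) (auto simp: g_J)
  show ?thesis
  proof (cases "v = w")
    case True
    have "(\<integral>\<^sup>+ x. (\<Prod>u\<in>insert w I - {v}. g ((x(w := a)) u) ((x(w := a)) v)) \<partial>(\<Pi>\<^sub>M i\<in>I. hyp_volume)) =
        (\<integral>\<^sup>+ x. (\<Prod>u\<in>I. g (x u) a) \<partial>(\<Pi>\<^sub>M i\<in>I. hyp_volume))"
      using I True by (intro nn_integral_cong prod.cong) auto
    also have "\<dots> < \<infinity>"
      using J I a by (simp add: star power_less_top_ennreal)
    finally show ?thesis
      by (simp add: g_def)
  next
    case False
    define K where "K = I - {v}"
    have K: "I = insert v K" "finite K" "v \<notin> K" "w \<notin> K"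
      using v I False by (auto simp: K_def)
    have sets: "insert w I - {v} = insert w K"
      using K False by auto
    have meas: "(\<lambda>x. g a (x v) * (\<Prod>u\<in>K. g (x u) (x v))) \<in>
        borel_measurable (\<Pi>\<^sub>M i\<in>insert v K. hyp_volume)"
    proof (intro borel_measurable_times_ennreal borel_measurable_prod_ennreal g_measurable)
      show "(\<lambda>x. a) \<in> (\<Pi>\<^sub>M i\<in>insert v K. hyp_volume) \<rightarrow>\<^sub>M hyp_volume"
        using a by (intro measurable_const) simp
    qed (auto intro!: measurable_component_singleton)
    have "(\<integral>\<^sup>+ x. (\<Prod>u\<in>insert w I - {v}. g ((x(w := a)) u) ((x(w := a)) v)) \<partial>(\<Pi>\<^sub>M i\<in>I. hyp_volume)) =
        (\<integral>\<^sup>+ x. g a (x v) * (\<Prod>u\<in>K. g (x u) (x v)) \<partial>(\<Pi>\<^sub>M i\<in>insert v K. hyp_volume))"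
    proof (unfold sets, subst K(1), rule nn_integral_cong)
      fix x :: "'a \<Rightarrow> real \<times> (real^3)"
      have "(\<Prod>u\<in>K. g ((x(w := a)) u) (x v)) = (\<Prod>u\<in>K. g (x u) (x v))"
        using K by (intro prod.cong) auto
      then show "(\<Prod>u\<in>insert w K. g ((x(w := a)) u) ((x(w := a)) v)) =
          g a (x v) * (\<Prod>u\<in>K. g (x u) (x v))"
        using K False by (simp del: fun_upd_apply add: fun_upd_same fun_upd_other)
    qed
    also have "\<dots> = (\<integral>\<^sup>+ y. (\<integral>\<^sup>+ x. g a ((x(v := y)) v) * (\<Prod>u\<in>K. g ((x(v := y)) u) ((x(v := y)) v))
        \<partial>(\<Pi>\<^sub>M i\<in>K. hyp_volume)) \<partial>hyp_volume)"
      using K meas by (intro product_nn_integral_insert_rev) auto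
    also have "\<dots> = (\<integral>\<^sup>+ y. g a y * J ^ card K \<partial>hyp_volume)"
    proof (rule nn_integral_cong)
      fix y assume "y \<in> space hyp_volume"
      then have y: "y \<in> hyp_space" by simp
      have "(\<Prod>u\<in>K. g ((x(v := y)) u) ((x(v := y)) v)) = (\<Prod>u\<in>K. g (x u) y)" for x
        using K by (intro prod.cong) auto
      then have "(\<integral>\<^sup>+ x. g a ((x(v := y)) v) * (\<Prod>u\<in>K. g ((x(v := y)) u) ((x(v := y)) v)) \<partial>(\<Pi>\<^sub>M i\<in>K. hyp_volume)) =
          (\<integral>\<^sup>+ x. g a y * (\<Prod>u\<in>K. g (x u) y) \<partial>(\<Pi>\<^sub>M i\<in>K. hyp_volume))"
        by simp
      also have "\<dots> = g a y * J ^ card K"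
      proof (subst nn_integral_cmult)
        show "(\<lambda>x. \<Prod>u\<in>K. g (x u) y) \<in> borel_measurable (\<Pi>\<^sub>M i\<in>K. hyp_volume)"
        proof (intro borel_measurable_prod_ennreal g_measurable)
          show "(\<lambda>x. y) \<in> (\<Pi>\<^sub>M i\<in>K. hyp_volume) \<rightarrow>\<^sub>M hyp_volume"
            using y by (intro measurable_const) simp
        qed (auto intro!: measurable_component_singleton)
      qed (use star[OF K(2) y] in simp)
      finally show "(\<integral>\<^sup>+ x. g a ((x(v := y)) v) * (\<Prod>u\<in>K. g ((x(v := y)) u) ((x(v := y)) v)) \<partial>(\<Pi>\<^sub>M i\<in>K. hyp_volume)) =
          g a y * J ^ card K" .
    qed
    \<comment> \<open>By symmetry of \<open>g\<close> the integration variable becomes the first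
      argument, as \<open>g_J\<close> requires.\<close>
    also have "\<dots> = (\<integral>\<^sup>+ y. g y a \<partial>hyp_volume) * J ^ card K"
    proof (subst nn_integral_multc)
      show "g a \<in> borel_measurable hyp_volume"
        by (rule g_measurable[of "\<lambda>_. a" _ "\<lambda>y. y"]) (use a in simp_all)
      have "g a = (\<lambda>y. g y a)"
        by (intro ext g_sym)
      then show "integral\<^sup>N hyp_volume (g a) * J ^ card K = (\<integral>\<^sup>+ y. g y a \<partial>hyp_volume) * J ^ card K"
        by simp
    qed
    also have "\<dots> < \<infinity>"
      using J by (simp add: g_J a ennreal_mult_less_top power_less_top_ennreal)
    finally show ?thesis
      by (simp add: g_def)
  qed
qed

section \<open>Integrability of complete graphs\<close>

theorem integrable_complete_graph:
  fixes G :: "('v, 'e) pre_digraph"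
  assumes G: "complete_graph n G" and n: "n \<ge> 5"
  shows "integrable_graph G"
proof -
  have "integrable_network G p" if p: "\<forall>e\<in>arcs G. p e \<ge> 0" for p
    unfolding integrable_network_def
  proof (intro ballI)
    fix w a assume w: "w \<in> verts G" and a: "a \<in> hyp_space"
    interpret fin_digraph G
      using G by (rule complete_graph_fin_digraph)
    let ?M = "\<Pi>\<^sub>M v\<in>verts G - {w}. hyp_volume"
    define C where "C = (20 :: real) ^ card (arcs G)"
    define g where "g x v = (\<Prod>u\<in>verts G - {v}.
      ennreal ((- lorentz ((x(w := a)) u) ((x(w := a)) v)) powr (-9/4)))" for x :: "'v \<Rightarrow> real \<times> (real^3)" and v
    have bound: "ennreal \<bar>edges_product G p (x(w := a))\<bar> \<le> ennreal C * (\<Sum>v\<in>verts G. g x v)"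
      if x: "x \<in> space ?M" for x
    proof -
      define y where "y = x(w := a)"
      have y: "y v \<in> hyp_space" if "v \<in> verts G" for v
        using x a that by (auto simp: y_def space_PiM PiE_iff)
      \<comment> \<open>Half the exponent of the kernel bound: squares give back
        \<open>-9/10\<close>, and fifth powers give the star weight \<open>-9/4\<close>, below the
        convergence threshold -2.\<close>
      define c where "c u v = (- lorentz (y u) (y v)) powr (-9/20)" for u v
      have c_square: "(c u v)\<^sup>2 = (- lorentz (y u) (y v)) powr (-9/10)" for u v
        by (simp add: c_def power2_eq_square flip: powr_add)
      \<comment> \<open>Claimed for arbitrary \<open>u\<close> and \<open>v\<close>, so a vanishing
        Lorentz product is a separate case: there \<open>powr\<close> with base 0 makes both sides
        0.\<close>
      have c_power5: "c u v ^ 5 = (- lorentz (y u) (y v)) powr (-9/4)" for u v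
        using powr_power[of "- lorentz (y u) (y v)" "-9/20" 5]
        by (cases "lorentz (y u) (y v) = 0") (simp_all add: c_def)
      have "\<bar>edges_product G p y\<bar> \<le> (\<Prod>e\<in>arcs G. 20 * (c (tail G e) (head G e))\<^sup>2)"
        unfolding edges_product_def abs_prod
      proof (intro prod_mono conjI)
        fix e assume "e \<in> arcs G"
        then show "\<bar>spin_kernel (p e) (hyp_dist (y (tail G e)) (y (head G e)))\<bar> \<le>
            20 * (c (tail G e) (head G e))\<^sup>2"
          using abs_spin_kernel_hyp_dist_le[of "p e" "y (tail G e)" "y (head G e)"] p y
          by (simp add: c_square)
      qed simp
      also have "\<dots> = C * (\<Prod>e\<in>arcs G. (c (tail G e) (head G e))\<^sup>2)"
        by (simp add: prod.distrib C_def)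
      also have "\<dots> \<le> C * (\<Sum>v\<in>verts G. \<Prod>u\<in>verts G - {v}. c u v ^ 5)"
      proof (intro mult_left_mono complete_graph_prod_arcs_le_sum_stars[OF G])
        fix u v assume "u \<in> verts G" "v \<in> verts G"
        then have "1 \<le> - lorentz (y u) (y v)"
          using lorentz_hyp_space_le[OF y y, of u v] by simp
        then show "c u v \<le> 1"
          using powr_mono[of "-9/20" 0 "- lorentz (y u) (y v)"] by (simp add: c_def)
      qed (use n in \<open>auto simp: c_def C_def lorentz_commute\<close>)
      also have "\<dots> = C * (\<Sum>v\<in>verts G. \<Prod>u\<in>verts G - {v}. (- lorentz (y u) (y v)) powr (-9/4))"
        by (simp add: c_power5)
      finally have "ennreal \<bar>edges_product G p y\<bar> \<le>
          ennreal (C * (\<Sum>v\<in>verts G. \<Prod>u\<in>verts G - {v}. (- lorentz (y u) (y v)) powr (-9/4)))"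
        by (rule ennreal_leI)
      also have "\<dots> = ennreal C * (\<Sum>v\<in>verts G. g x v)"
        by (simp add: g_def C_def ennreal_mult' sum_nonneg prod_nonneg flip: y_def sum_ennreal prod_ennreal)
      finally show ?thesis
        by (simp add: y_def)
    qed
    have measurable_g: "(\<lambda>x. g x v) \<in> borel_measurable ?M" if "v \<in> verts G" for v
    proof -
      have "(\<lambda>x. (x(w := a)) u) \<in> ?M \<rightarrow>\<^sub>M hyp_volume" if "u \<in> verts G" for u
        using that a by (cases "u = w") (auto intro!: measurable_component_singleton)
      then show ?thesis
        unfolding g_def using that
        by (intro borel_measurable_prod_ennreal measurable_lorentz_powr_hyp_volume) auto
    qed
    have g_finite: "(\<integral>\<^sup>+ x. g x v \<partial>?M) < \<infinity>" if "v \<in> verts G" for v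
      using nn_integral_star_finite[of "verts G - {w}" w a v] that a w
      by (simp add: g_def insert_absorb)
    \<comment> \<open>The comparison is pointwise on the product space; measurability of
      \<open>g\<close> then serves to pull the constant and the sum over centres out of the
      integral.\<close>
    have "(\<integral>\<^sup>+ x. ennreal \<bar>edges_product G p (x(w := a))\<bar> \<partial>?M) \<le>
        (\<integral>\<^sup>+ x. ennreal C * (\<Sum>v\<in>verts G. g x v) \<partial>?M)"
      by (intro nn_integral_mono bound)
    also have "\<dots> = ennreal C * (\<Sum>v\<in>verts G. \<integral>\<^sup>+ x. g x v \<partial>?M)"
      using measurable_g by (simp add: nn_integral_cmult nn_integral_sum)
    also have "\<dots> < \<infinity>"
      using g_finite by (simp add: ennreal_mult_less_top)
    finally show "(\<integral>\<^sup>+ x. ennreal \<bar>edges_product G p (x(w := a))\<bar> \<partial>?M) < \<infinity>" .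
  qed
  then show ?thesis
    using complete_graph_fin_digraph[OF G] complete_graph_connected[OF G] n
    by (simp add: integrable_graph_def)
qed

theorem mainTheorem4:
  fixes \<Gamma> :: "('v, 'e) pre_digraph"
  assumes "complete_graph 5 \<Gamma>"
  shows "integrable_graph \<Gamma>"
  using assms by (rule integrable_complete_graph) simp

end
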